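(* Let $\alpha \geq 1$ be a real number and let $S$ be an infinite set of positive integers of polynomial density $\alpha$. Let $P(S)$ be the set of primes dividing at least one element of $S$, and let $\pi_S(n) = \operatorname{card}\{p \in P(S) : p \leq n\}$. Then: (a) The set $P(S)$ is infinite. (b) Let $r > 1$ be a real number. Then for every integer $k \geq 1$ there are infinitely many positive integers $n$ with $\log_k n > 0$ such that $$\pi_S(n) \geq \frac{n^{1/\alpha}}{\left(\prod_{j=1}^{k-1} \log_j n\right) (\log_k n)^r}.$$ In particular, $\pi_S(n) \geq n^{1/\alpha}/(\log n)^r$ for infinitely many $n$ (the case $k=1$), and $\pi_S(n) \geq n^{1/\alpha}/\bigl(\log n\,(\log\log n)^r\bigr)$ for infinitely many $n$ (the case $k=2$).
   Context: For real $\alpha \geq 1$ (not necessarily an integer), an infinite set $S$ of positive integers is said to have polynomial density $\alpha$ if $S$ is the range of a strictly increasing sequence $(s_n)_{n=1}^\infty$ of positive integers such that $s_n = O(n^\alpha)$, i.e. there is a constant $C > 0$ with $s_n \leq C n^\alpha$ for all $n \geq 1$. (Only this upper bound is required.) The set of prime factors of elements of $S$ is $$P(S) = \{p : p \text{ is prime and } p \mid s \text{ for at least one } s \in S\}.$$ Here $\log$ is the natural logarithm and $\log_j$ denotes the $j$-fold iterated natural logarithm: $\log_1 n = \log n$ and $\log_{j+1} n = \log(\log_j n)$, defined whenever $\log_j n > 0$. An empty product equals $1$. If $\log_k n$ is defined and positive, then $\log_j n$ is positive for all $1 \leq j \leq k$. *)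

theory Defs
  imports Complex_Main "HOL-Computational_Algebra.Primes"
begin

(* The enumerating sequence is indexed from 1; its value at 0 is irrelevant. *)
definition poly_density :: "real \<Rightarrow> nat set \<Rightarrow> bool" where
  "poly_density \<alpha> S \<longleftrightarrow>
     (\<exists>s :: nat \<Rightarrow> nat. strict_mono_on {1..} s \<and> s ` {1..} = S \<and>
        (\<exists>C > 0. \<forall>n \<ge> 1. real (s n) \<le> C * real n powr \<alpha>))"

definition prime_divisors_of :: "nat set \<Rightarrow> nat set" where
  "prime_divisors_of S = {p. prime p \<and> (\<exists>s \<in> S. p dvd s)}"

definition prime_count_of :: "nat set \<Rightarrow> nat \<Rightarrow> nat" where
  "prime_count_of S n = card {p \<in> prime_divisors_of S. p \<le> n}"

definition iter_ln :: "nat \<Rightarrow> real \<Rightarrow> real" where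
  "iter_ln j x = (ln ^^ j) x"

(* The function ln is total, and ln x can be positive for x < 0, so positivity of
   iter_ln k x alone does not say that the k-fold logarithm of x exists: all
   the preceding iterates (x itself is the one for j = 0) have to be positive. *)
definition iter_ln_defined :: "nat \<Rightarrow> real \<Rightarrow> bool" where
  "iter_ln_defined k x \<longleftrightarrow> (\<forall>j < k. iter_ln j x > 0)"

end

theory Submission
  imports Defs "HOL-Analysis.Summation_Tests"
begin

text \<open>
  If $\sum_{p \in P(S)} p^{-1/\alpha}$ were finite, then so would be the Euler product
  $\prod_{p \in P(S)} (1 - p^{-1/\alpha})^{-1}$, which dominates $\sum_{s \in S} s^{-1/\alpha}$. But
  $s_n \le C n^\alpha$ makes the latter sum dominate a multiple of the harmonic series. So
  $\sum_{p \in P(S)} p^{-1/\alpha}$ diverges and $P(S)$ is infinite. If the inequality in (b) failed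
  for all large $n$, then putting $n = q_i$, the $i$-th element of $P(S)$, would bound
  $q_i^{-1/\alpha}$ by the $i$-th term of the convergent series
  $\sum 1 / (n \log n \cdots \log_{k-1} n\, (\log_k n)^r)$.
\<close>

section \<open>Partial Euler products\<close>

lemma prime_powr_minus_less_1:
  fixes p :: nat and \<beta> :: real
  assumes "prime p" "\<beta> > 0"
  shows "real p powr - \<beta> < 1"
  using prime_gt_1_nat[OF assms(1)] assms(2) powr_less_one[of "real p" "-\<beta>"] by simp

text \<open>Induction on \<open>F\<close>: splitting off the full power of the new prime
  \<open>p\<close> from each \<open>a\<close> leaves a cofactor with prime factors in the old
  \<open>F\<close>. The powers of \<open>p\<close> form a partial geometric series, the cofactors
  fall under the induction hypothesis. As \<open>A\<close> is finite, no infinite product is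
  needed.\<close>

lemma sum_powr_minus_le_euler_product:
  fixes \<beta> :: real
  assumes "\<beta> > 0" "finite F" "\<And>p. p \<in> F \<Longrightarrow> prime p"
    and "finite A" "\<And>a. a \<in> A \<Longrightarrow> a > 0 \<and> prime_factors a \<subseteq> F"
  shows "(\<Sum>a\<in>A. real a powr - \<beta>) \<le> (\<Prod>p\<in>F. 1 / (1 - real p powr - \<beta>))"
  using assms(2-)
proof (induction F arbitrary: A rule: finite_induct)
  case empty
  have "A \<subseteq> {1}"
  proof
    fix a assume "a \<in> A"
    with empty have "a > 0" "prime_factors a = {}" by auto
    then have "a = 1" by (simp add: prime_factorization_empty_iff)
    then show "a \<in> {1}" by simp
  qed
  then have "(\<Sum>a\<in>A. real a powr - \<beta>) \<le> (\<Sum>a\<in>{1::nat}. real a powr - \<beta>)"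
    by (intro sum_mono2) auto
  then show ?case by simp
next
  case (insert p F)
  define g where "g = (\<lambda>a::nat. real a powr - \<beta>)"
  have gmult: "g (a * b) = g a * g b" for a b
    by (simp add: g_def powr_mult)
  have gpow: "g (p ^ k) = g p ^ k" for k
    by (induction k) (simp_all add: gmult, simp add: g_def)
  have p: "prime p" using insert.prems by simp
  \<comment> \<open>Unique factorization with respect to \<open>p\<close>: \<open>e\<close> embeds
    \<open>A\<close> into a rectangle of exponents and cofactors. Summing over the whole rectangle
    only adds nonnegative terms, and the complete multiplicativity of \<open>g\<close> makes that
    sum a product.\<close>
  define e where "e = (\<lambda>a. (multiplicity p a, a div p ^ multiplicity p a))"
  define B where "B = (\<lambda>a. a div p ^ multiplicity p a) ` A"
  define K where "K = Suc (Max (multiplicity p ` A))"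
  have decomp: "p ^ multiplicity p a * (a div p ^ multiplicity p a) = a" for a
    by (simp add: multiplicity_dvd)
  have inj: "inj_on e A"
    by (rule inj_onI) (metis e_def decomp prod.inject)
  have eA: "e ` A \<subseteq> {..<K} \<times> B"
    using insert.prems by (auto simp: e_def B_def K_def less_Suc_eq_le)
  have gp: "g p < 1" "0 \<le> g p"
    using prime_powr_minus_less_1[OF p \<open>\<beta> > 0\<close>] by (auto simp: g_def)
  have "(\<Sum>a\<in>A. g a) = (\<Sum>(k, b)\<in>e ` A. g p ^ k * g b)"
    unfolding sum.reindex[OF inj]
    by (intro sum.cong) (simp_all add: e_def flip: gpow gmult, simp add: decomp)
  also have "\<dots> \<le> (\<Sum>(k, b)\<in>{..<K} \<times> B. g p ^ k * g b)"
    using insert.prems eA by (intro sum_mono2) (auto simp: B_def g_def)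
  also have "\<dots> = (\<Sum>k<K. g p ^ k) * (\<Sum>b\<in>B. g b)"
    by (simp add: sum_product sum.cartesian_product)
  also have "\<dots> \<le> (1 / (1 - g p)) * (\<Prod>q\<in>F. 1 / (1 - real q powr - \<beta>))"
  proof (rule mult_mono)
    have "(\<Sum>k<K. g p ^ k) = (1 - g p ^ K) / (1 - g p)"
      using gp by (simp add: sum_gp_strict)
    also have "\<dots> \<le> 1 / (1 - g p)"
      using gp by (intro divide_right_mono) auto
    finally show "(\<Sum>k<K. g p ^ k) \<le> 1 / (1 - g p)" .
    show "(\<Sum>b\<in>B. g b) \<le> (\<Prod>q\<in>F. 1 / (1 - real q powr - \<beta>))"
      unfolding g_def
    proof (rule insert.IH)
      show "finite B" using insert.prems by (simp add: B_def)
      fix b assume "b \<in> B"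
      then obtain a where a: "a \<in> A" "b = a div p ^ multiplicity p a"
        by (auto simp: B_def)
      have a0: "a > 0" "prime_factors a \<subseteq> insert p F" using insert.prems a by auto
      have ab: "a = p ^ multiplicity p a * b" using decomp a by simp
      then have b0: "b > 0" using a0 by (metis gr0I mult_0_right)
      \<comment> \<open>This removes \<open>p\<close> from the admissible prime factors, so that
        \<open>insert p F\<close> shrinks to \<open>F\<close>.\<close>
      have "\<not> p dvd b"
        using a(2) a0(1) p multiplicity_decompose[of a p] not_prime_unit[of p] by blast
      moreover have "prime_factors b \<subseteq> prime_factors a"
        using ab a0 by (intro dvd_prime_factors) (auto, metis dvd_triv_right)
      ultimately show "b > 0 \<and> prime_factors b \<subseteq> F"
        using a0 b0 by (auto simp: in_prime_factors_iff)
    qed (use insert.prems in auto)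
  qed (use gp in \<open>auto intro!: sum_nonneg simp: g_def\<close>)
  finally show ?case using insert.hyps by (simp add: g_def)
qed

text \<open>Each factor is 1 + x/(1-x) with x = p^(-\<beta>), hence at most exp(x/(1-x)). Since p is
  at least 2, replacing 1-x by 1 - 2^(-\<beta>) gives one constant for all primes.\<close>

lemma euler_product_le_exp:
  fixes \<beta> :: real
  assumes "\<beta> > 0" "finite F" "\<And>p. p \<in> F \<Longrightarrow> prime p"
  shows "(\<Prod>p\<in>F. 1 / (1 - real p powr - \<beta>))
    \<le> exp ((\<Sum>p\<in>F. real p powr - \<beta>) / (1 - 2 powr - \<beta>))"
proof -
  have "(\<Prod>p\<in>F. 1 / (1 - real p powr - \<beta>))
      \<le> (\<Prod>p\<in>F. exp (real p powr - \<beta> / (1 - 2 powr - \<beta>)))"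
  proof (rule prod_mono, safe)
    fix p assume "p \<in> F"
    then have p: "prime p" using assms by simp
    define x where "x = real p powr - \<beta>"
    have x1: "x < 1" using prime_powr_minus_less_1[OF p \<open>\<beta> > 0\<close>] by (simp add: x_def)
    have x2: "x \<le> 2 powr - \<beta>"
      unfolding x_def using prime_ge_2_nat[OF p] \<open>\<beta> > 0\<close>
      by (intro powr_mono2') auto
    have two: "2 powr - \<beta> < 1"
      using prime_powr_minus_less_1[OF two_is_prime_nat \<open>\<beta> > 0\<close>] by simp
    show "0 \<le> 1 / (1 - real p powr - \<beta>)" using x1 by (simp add: x_def)
    have "1 / (1 - x) = 1 + x / (1 - x)" using x1 by (simp add: field_simps)
    also have "\<dots> \<le> exp (x / (1 - x))" by (rule exp_ge_add_one_self)
    also have "\<dots> \<le> exp (x / (1 - 2 powr - \<beta>))"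
      using x1 x2 two by (auto intro!: divide_left_mono simp: x_def)
    finally show "1 / (1 - real p powr - \<beta>) \<le> exp (real p powr - \<beta> / (1 - 2 powr - \<beta>))"
      by (simp add: x_def)
  qed
  also have "\<dots> = exp ((\<Sum>p\<in>F. real p powr - \<beta>) / (1 - 2 powr - \<beta>))"
    using assms by (simp add: exp_sum sum_divide_distrib)
  finally show ?thesis .
qed

text \<open>Divergence is expressed through finite subsets, so it makes sense before
  \<open>prime_divisors_of S\<close> is known to be infinite and does not depend on an
  enumeration.\<close>

lemma sum_prime_divisors_unbounded:
  assumes "\<alpha> \<ge> 1" "\<forall>s\<in>S. s > 0" "poly_density \<alpha> S"
  shows "\<exists>F. finite F \<and> F \<subseteq> prime_divisors_of S \<and> (\<Sum>p\<in>F. real p powr - (1 / \<alpha>)) > M"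
proof (rule ccontr)
  assume "\<not> ?thesis"
  then have bound: "(\<Sum>p\<in>F. real p powr - (1 / \<alpha>)) \<le> M"
    if "finite F" "F \<subseteq> prime_divisors_of S" for F
    using that by (meson not_less)
  \<comment> \<open>With this exponent, (n^\<alpha>)^(-\<beta>) is exactly 1/n, the harmonic
    term.\<close>
  define \<beta> where "\<beta> = 1 / \<alpha>"
  have \<beta>: "\<beta> > 0" "\<alpha> * \<beta> = 1" using assms(1) by (auto simp: \<beta>_def)
  obtain s C where s: "strict_mono_on {1..} s" "s ` {1..} = S" "C > 0"
    and sC: "\<And>n. n \<ge> 1 \<Longrightarrow> real (s n) \<le> C * real n powr \<alpha>"
    using assms(3) unfolding poly_density_def by blast
  have spos: "s n > 0" if "n \<ge> 1" for n using assms(2) s(2) that by auto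
  define E where "E = exp (M / (1 - 2 powr - \<beta>))"
  have two: "2 powr - \<beta> < 1"
    using prime_powr_minus_less_1[OF two_is_prime_nat \<open>\<beta> > 0\<close>] by simp
  have Sbound: "(\<Sum>a\<in>A. real a powr - \<beta>) \<le> E" if A: "finite A" "A \<subseteq> S" for A
  proof -
    \<comment> \<open>All primes that \<open>A\<close> involves. They lie in
      \<open>prime_divisors_of S\<close>, so \<open>M\<close> bounds their sum and \<open>E\<close>
      does not depend on \<open>A\<close>.\<close>
    define F where "F = (\<Union>a\<in>A. prime_factors a)"
    have F: "finite F" "F \<subseteq> prime_divisors_of S" "\<And>p. p \<in> F \<Longrightarrow> prime p"
      using A by (auto simp: F_def prime_divisors_of_def in_prime_factors_iff)
    have "(\<Sum>a\<in>A. real a powr - \<beta>) \<le> (\<Prod>p\<in>F. 1 / (1 - real p powr - \<beta>))"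
      using A F assms(2) \<beta> by (intro sum_powr_minus_le_euler_product) (auto simp: F_def)
    also have "\<dots> \<le> exp ((\<Sum>p\<in>F. real p powr - \<beta>) / (1 - 2 powr - \<beta>))"
      using F \<beta> by (intro euler_product_le_exp) auto
    also have "\<dots> \<le> E"
      using bound[OF F(1,2)] two by (auto simp: E_def \<beta>_def intro!: divide_right_mono)
    finally show ?thesis .
  qed
  have term_le: "C powr - \<beta> * inverse (real n) \<le> real (s n) powr - \<beta>" if "n \<ge> 1" for n
  proof -
    have "(C * real n powr \<alpha>) powr - \<beta> \<le> real (s n) powr - \<beta>"
      using sC[OF that] spos[OF that] \<beta> by (intro powr_mono2') auto
    also have "(C * real n powr \<alpha>) powr - \<beta> = C powr - \<beta> * inverse (real n)"
      using that s(3) \<beta> by (simp add: powr_mult powr_powr powr_minus)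
    finally show ?thesis .
  qed
  have "summable (\<lambda>n. C powr - \<beta> * inverse (real (Suc n)))"
  proof (rule bounded_imp_summable)
    fix N
    have "(\<Sum>n\<le>N. C powr - \<beta> * inverse (real (Suc n))) \<le> (\<Sum>n\<le>N. real (s (Suc n)) powr - \<beta>)"
      by (intro sum_mono term_le) auto
    also have "\<dots> = (\<Sum>a\<in>(\<lambda>n. s (Suc n)) ` {..N}. real a powr - \<beta>)"
    proof -
      \<comment> \<open>Distinct indices give distinct elements, so the sum over indices is a sum
        over a finite subset of \<open>S\<close>.\<close>
      have "inj_on (\<lambda>n. s (Suc n)) {..N}"
        using strict_mono_on_imp_inj_on[OF s(1)] by (auto simp: inj_on_def)
      then show ?thesis by (simp add: sum.reindex)
    qed
    also have "\<dots> \<le> E" using s(2) by (intro Sbound) auto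
    finally show "(\<Sum>n\<le>N. C powr - \<beta> * inverse (real (Suc n))) \<le> E" .
  qed auto
  then have "summable (\<lambda>n. inverse (real (Suc n)))"
    using s(3) by (subst (asm) summable_cmult_iff) auto
  then have "summable (\<lambda>n. inverse (real n))" by (rule summable_Suc_iff[THEN iffD1])
  then show False using not_summable_harmonic[where 'a = real] by simp
qed

section \<open>Iterated logarithms\<close>

lemma iter_ln_0 [simp]: "iter_ln 0 x = x"
  and iter_ln_Suc [simp]: "iter_ln (Suc j) x = ln (iter_ln j x)"
  by (simp_all add: iter_ln_def)

text \<open>Below, \<open>iter_ln_defined (Suc k) x\<close> serves as the compact form of "the
  \<open>k\<close>-fold logarithm of \<open>x\<close> exists and is positive".\<close>

lemma iter_ln_defined_Suc_iff:
  "iter_ln_defined (Suc k) x \<longleftrightarrow> iter_ln_defined k x \<and> iter_ln k x > 0"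
  by (auto simp: iter_ln_defined_def less_Suc_eq)

lemma iter_ln_pos: "iter_ln_defined k x \<Longrightarrow> j < k \<Longrightarrow> iter_ln j x > 0"
  by (simp add: iter_ln_defined_def)

lemma iter_ln_mono:
  assumes "iter_ln_defined k x" "x \<le> y" "j \<le> k"
  shows "iter_ln j x \<le> iter_ln j y"
  using assms(3)
proof (induction j)
  case (Suc j)
  then have "0 < iter_ln j x" "iter_ln j x \<le> iter_ln j y"
    using iter_ln_pos[OF assms(1)] by auto
  then show ?case by simp
qed (use assms(2) in simp)

lemma iter_ln_defined_mono:
  assumes "iter_ln_defined k x" "x \<le> y"
  shows "iter_ln_defined k y"
  unfolding iter_ln_defined_def
  using iter_ln_pos[OF assms(1)] iter_ln_mono[OF assms] by (meson less_imp_le less_le_trans)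

lemma filterlim_iter_ln: "filterlim (iter_ln k) at_top at_top"
proof (induction k)
  case 0
  then show ?case by (simp add: filterlim_ident[unfolded id_def] iter_ln_def id_def)
next
  case (Suc k)
  from filterlim_compose[OF ln_at_top Suc] show ?case by (simp add: iter_ln_Suc[abs_def])
qed

lemma eventually_iter_ln_defined: "eventually (\<lambda>x. iter_ln_defined k x) at_top"
proof (induction k)
  case (Suc k)
  have "eventually (\<lambda>x. iter_ln k x > 0) at_top"
    using filterlim_iter_ln[of k] by (simp add: filterlim_at_top_dense)
  with Suc show ?case by eventually_elim (simp add: iter_ln_defined_Suc_iff)
qed (simp add: iter_ln_defined_def)

text \<open>Chain rule, one logarithm at a time; the factor for \<open>j = 0\<close> is
  \<open>x\<close> itself.\<close>

lemma has_field_derivative_iter_ln: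
  assumes "iter_ln_defined k x"
  shows "(iter_ln k has_field_derivative 1 / (\<Prod>j<k. iter_ln j x)) (at x)"
  using assms
proof (induction k)
  case 0
  then show ?case by (simp add: iter_ln_def id_def)
next
  case (Suc k)
  then have "iter_ln k x > 0" "(iter_ln k has_field_derivative 1 / (\<Prod>j<k. iter_ln j x)) (at x)"
    by (auto simp: iter_ln_defined_Suc_iff)
  then have "((\<lambda>x. ln (iter_ln k x)) has_field_derivative
      1 / (\<Prod>j<k. iter_ln j x) / iter_ln k x) (at x)"
    by (auto intro!: derivative_eq_intros)
  moreover have "iter_ln (Suc k) = (\<lambda>x. ln (iter_ln k x))" by (simp add: fun_eq_iff)
  ultimately show ?case by (simp add: mult.commute)
qed

section \<open>The denominator in (b) and the convergence of its Bertrand-type series\<close>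

definition iter_ln_weight :: "nat \<Rightarrow> real \<Rightarrow> real \<Rightarrow> real" where
  "iter_ln_weight k r x = (\<Prod>j\<in>{1..k - 1}. iter_ln j x) * iter_ln k x powr r"

lemma iter_ln_weight_pos:
  assumes "iter_ln_defined (Suc k) x"
  shows "iter_ln_weight k r x > 0"
proof -
  have pos: "iter_ln j x > 0" if "j \<le> k" for j
    using iter_ln_pos[OF assms] that by simp
  have "(\<Prod>j\<in>{1..k - 1}. iter_ln j x) > 0"
    using pos by (intro prod_pos) auto
  moreover have "iter_ln k x powr r > 0" using pos[of k] by simp
  ultimately show ?thesis unfolding iter_ln_weight_def by (rule mult_pos_pos)
qed

lemma iter_ln_weight_mono:
  assumes "iter_ln_defined (Suc k) x" "x \<le> y" "r \<ge> 0"
  shows "iter_ln_weight k r x \<le> iter_ln_weight k r y"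
proof -
  have pos: "0 < iter_ln j x" if "j \<le> k" for j
    using iter_ln_pos[OF assms(1)] that by auto
  have mono: "iter_ln j x \<le> iter_ln j y" if "j \<le> k" for j
    using iter_ln_mono[OF assms(1,2)] that by auto
  have 1: "(\<Prod>j\<in>{1..k - 1}. iter_ln j x) \<le> (\<Prod>j\<in>{1..k - 1}. iter_ln j y)"
    using pos mono by (intro prod_mono) (auto intro: less_imp_le)
  have 2: "iter_ln k x powr r \<le> iter_ln k y powr r"
    using pos[of k] mono[of k] assms(3) by (intro powr_mono2) auto
  have 3: "0 \<le> (\<Prod>j\<in>{1..k - 1}. iter_ln j x)"
    using pos by (intro prod_nonneg) (auto intro: less_imp_le)
  show ?thesis
    unfolding iter_ln_weight_def using 1 2 3 by (intro mult_mono) auto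
qed

text \<open>Provides, up to the constant 1-r, a primitive of the terms of the series for the
  integral test.\<close>

lemma has_field_derivative_iter_ln_powr:
  assumes "iter_ln_defined (Suc k) x" "k \<ge> 1"
  shows "((\<lambda>x. iter_ln k x powr (1 - r)) has_field_derivative
    (1 - r) / (x * iter_ln_weight k r x)) (at x)"
proof -
  have D: "iter_ln_defined k x" and pos: "iter_ln k x > 0"
    using assms(1) by (auto simp: iter_ln_defined_Suc_iff)
  \<comment> \<open>The derivative's product starts at \<open>j = 0\<close>, the weight's at
    \<open>j = 1\<close>; the difference is the factor \<open>x\<close>.\<close>
  have "{..<k} = insert 0 {1..k - 1}" using assms(2) by auto
  then have prod: "(\<Prod>j<k. iter_ln j x) = x * (\<Prod>j\<in>{1..k - 1}. iter_ln j x)" by simp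
  have "((\<lambda>x. iter_ln k x powr (1 - r)) has_field_derivative
      (1 - r) * iter_ln k x powr (1 - r - of_nat 1) * (1 / (\<Prod>j<k. iter_ln j x))) (at x)"
    using has_field_derivative_iter_ln[OF D] pos by (rule DERIV_fun_powr)
  moreover have "(1 - r) * iter_ln k x powr (1 - r - of_nat 1) * (1 / (\<Prod>j<k. iter_ln j x))
      = (1 - r) / (x * iter_ln_weight k r x)"
    unfolding prod iter_ln_weight_def by (simp add: powr_minus divide_inverse mult_ac)
  ultimately show ?thesis by simp
qed

text \<open>Integral test by hand: \<open>h\<close> is decreasing from \<open>N\<close> on and
  \<open>G\<close> is a nonnegative function with derivative \<open>- h\<close> there. Telescoping
  bounds the partial sums beyond \<open>N\<close> by \<open>G N\<close>.\<close>

lemma summable_iter_ln_weight: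
  assumes "k \<ge> 1" "r > 1"
  shows "summable (\<lambda>n. 1 / (real n * iter_ln_weight k r (real n)))"
proof -
  obtain x0 where "iter_ln_defined (Suc k) x0"
    using eventually_happens'[OF _ eventually_iter_ln_defined[of "Suc k"]] by auto
  then have D: "iter_ln_defined (Suc k) x" if "x \<ge> real (nat \<lceil>x0\<rceil>)" for x
    using that iter_ln_defined_mono[of "Suc k" x0 x] by linarith
  define N where "N = nat \<lceil>x0\<rceil>"
  define h where "h = (\<lambda>x. 1 / (x * iter_ln_weight k r x))"
  define G where "G = (\<lambda>x. iter_ln k x powr (1 - r) / (r - 1))"
  have xpos: "x > 0" if "x \<ge> real N" for x
    using iter_ln_pos[OF D, of x 0] that by (simp add: N_def)
  have hpos: "h x > 0" if "x \<ge> real N" for x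
    using iter_ln_weight_pos[OF D] xpos that by (simp add: h_def N_def)
  have hanti: "h y \<le> h x" if "x \<ge> real N" "x \<le> y" for x y
  proof -
    have "x * iter_ln_weight k r x \<le> y * iter_ln_weight k r y"
      using that xpos[of x] iter_ln_weight_pos[OF D, of x r] iter_ln_weight_mono[OF D, of x y r] assms(2)
      by (intro mult_mono) (auto simp: N_def)
    then show ?thesis
      using that xpos[of x] iter_ln_weight_pos[OF D, of x r]
      unfolding h_def by (intro divide_left_mono mult_pos_pos) (auto simp: N_def
          intro!: mult_pos_pos iter_ln_weight_pos[OF D])
  qed
  have dG: "(G has_field_derivative - h x) (at x)" if "x \<ge> real N" for x
  proof -
    have "(G has_field_derivative (1 - r) / (x * iter_ln_weight k r x) / (r - 1)) (at x)"
      unfolding G_def using D that assms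
      by (intro DERIV_cdivide has_field_derivative_iter_ln_powr) (auto simp: N_def)
    moreover have "(1 - r) / (x * iter_ln_weight k r x) / (r - 1) = - h x"
    proof -
      have "(1 - r) / y / (r - 1) = - (1 / y)" for y
        using assms(2) by (cases "y = 0") (simp_all add: field_simps)
      then show ?thesis by (simp add: h_def)
    qed
    ultimately show ?thesis by simp
  qed
  \<comment> \<open>By the mean value theorem the right side is \<open>h z\<close> for some
    \<open>z\<close> below \<open>Suc n\<close>, and \<open>h\<close> decreases.\<close>
  have step: "h (real (Suc n)) \<le> G (real n) - G (real (Suc n))" if n: "n \<ge> N" for n
  proof -
    obtain z where z: "real n < z" "z < real (Suc n)"
        "G (real (Suc n)) - G (real n) = (real (Suc n) - real n) * (- h z)"
      using MVT2[of "real n" "real (Suc n)" G "\<lambda>x. - h x"] dG n by auto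
    then show ?thesis using hanti[of z "real (Suc n)"] n by auto
  qed
  have Gpos: "G x \<ge> 0" for x using assms by (simp add: G_def)
  have tele: "(\<Sum>i<m. h (real (Suc (i + N)))) \<le> G (real N) - G (real (m + N))" for m
  proof (induction m)
    case (Suc m)
    then show ?case using step[of "m + N"] by simp
  qed simp
  have "summable (\<lambda>i. h (real (Suc (i + N))))"
  proof (rule bounded_imp_summable)
    show "(\<Sum>i\<le>m. h (real (Suc (i + N)))) \<le> G (real N)" for m
      using tele[of "Suc m"] Gpos[of "real (Suc m + N)"] by (simp add: lessThan_Suc_atMost)
    show "0 \<le> h (real (Suc (i + N)))" for i
      using hpos[of "real (Suc (i + N))"] by simp
  qed
  \<comment> \<open>The finitely many omitted terms, where logarithms may be undefined or
    nonpositive, do not affect convergence.\<close>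
  then have "summable (\<lambda>i. h (real (i + Suc N)))" by simp
  then have "summable (\<lambda>i. h (real i))"
    by (subst (asm) summable_iff_shift[where f = "\<lambda>i. h (real i)"])
  then show ?thesis by (simp add: h_def)
qed

section \<open>Counting the prime divisors\<close>

text \<open>If the set were finite, its total sum would bound the sums over all its subsets.\<close>

lemma infinite_prime_divisors_of:
  assumes "\<alpha> \<ge> 1" "\<forall>s\<in>S. s > 0" "poly_density \<alpha> S"
  shows "infinite (prime_divisors_of S)"
proof
  assume fin: "finite (prime_divisors_of S)"
  obtain F where F: "F \<subseteq> prime_divisors_of S"
    "(\<Sum>p\<in>F. real p powr - (1 / \<alpha>)) > (\<Sum>p\<in>prime_divisors_of S. real p powr - (1 / \<alpha>))"
    using sum_prime_divisors_unbounded[OF assms] by blast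
  have "(\<Sum>p\<in>F. real p powr - (1 / \<alpha>)) \<le> (\<Sum>p\<in>prime_divisors_of S. real p powr - (1 / \<alpha>))"
    using fin F by (intro sum_mono2) auto
  with F show False by simp
qed

text \<open>\<open>enumerate\<close> counts from 0, hence the \<open>Suc\<close>.\<close>

lemma card_le_enumerate:
  fixes P :: "nat set"
  assumes "infinite P"
  shows "card {p \<in> P. p \<le> enumerate P i} = Suc i"
proof -
  have "{p \<in> P. p \<le> enumerate P i} = enumerate P ` {..i}"
  proof safe
    fix p assume "p \<in> P" "p \<le> enumerate P i"
    then show "p \<in> enumerate P ` {..i}"
      using enumerate_Ex[of P p] assms by (metis atMost_iff enumerate_mono_le_iff imageI)
  qed (use assms in \<open>auto simp: enumerate_in_set\<close>)
  moreover have "inj_on (enumerate P) {..i}"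
    using assms by (meson bij_betw_imp_inj_on bij_enumerate inj_on_subset subset_UNIV)
  ultimately show ?thesis by (simp add: card_image)
qed

lemma infinite_prime_count_ge:
  assumes "\<alpha> \<ge> 1" "\<forall>s\<in>S. s > 0" "poly_density \<alpha> S" "r > 1" "k \<ge> 1"
  shows "infinite {n :: nat. n > 0 \<and> iter_ln_defined k (real n) \<and> iter_ln k (real n) > 0 \<and>
    real (prime_count_of S n) \<ge> real n powr (1 / \<alpha>) / iter_ln_weight k r (real n)}"
    (is "infinite {n. ?A n}")
proof
  assume "finite {n. ?A n}"
  then have "eventually (\<lambda>n. \<not> ?A n) sequentially"
    unfolding cofinite_eq_sequentially[symmetric] eventually_cofinite not_not .
  moreover have "eventually (\<lambda>n. iter_ln_defined (Suc k) (real n)) sequentially"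
    using eventually_iter_ln_defined filterlim_real_sequentially
    by (rule eventually_compose_filterlim)
  \<comment> \<open>For large \<open>n\<close> the side conditions in \<open>?A\<close> hold
    automatically, so only its inequality can fail.\<close>
  ultimately have "eventually (\<lambda>n. iter_ln_defined (Suc k) (real n) \<and>
      real (prime_count_of S n) < real n powr (1 / \<alpha>) / iter_ln_weight k r (real n)) sequentially"
    using eventually_gt_at_top[of 0]
    by eventually_elim (auto simp: iter_ln_defined_Suc_iff)
  then obtain N where N: "\<And>n. n \<ge> N \<Longrightarrow> iter_ln_defined (Suc k) (real n)"
      "\<And>n. n \<ge> N \<Longrightarrow> real (prime_count_of S n) < real n powr (1 / \<alpha>) / iter_ln_weight k r (real n)"
    unfolding eventually_sequentially by blast
  define P where "P = prime_divisors_of S"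
  define q where "q = enumerate P"
  have inf: "infinite P" using infinite_prime_divisors_of[OF assms(1-3)] by (simp add: P_def)
  have prime: "prime (q i)" for i
    using enumerate_in_set[OF inf, of i] by (simp add: q_def P_def prime_divisors_of_def)
  \<comment> \<open>This bound serves twice: it places \<open>q i\<close> beyond \<open>N\<close>
    when \<open>i\<close> is, and it lets the weight at \<open>q i\<close> be replaced by the
    smaller one at \<open>Suc i\<close>, giving a term of the convergent series.\<close>
  have q_gt: "Suc i \<le> q i" for i
  proof (induction i)
    case 0
    show ?case using prime_gt_0_nat[OF prime[of 0]] by simp
  next
    case (Suc i)
    then show ?case using enumerate_step[OF inf, of i] by (simp add: q_def)
  qed
  have term_le: "real (q i) powr - (1 / \<alpha>) \<le> 1 / (real (Suc i) * iter_ln_weight k r (real (Suc i)))"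
    if i: "i \<ge> N" for i
  proof -
    define w where "w = iter_ln_weight k r (real (q i))"
    have D: "iter_ln_defined (Suc k) (real (Suc i))" using N(1)[of "Suc i"] i by simp
    have v: "iter_ln_weight k r (real (Suc i)) > 0" using iter_ln_weight_pos[OF D] .
    have w: "iter_ln_weight k r (real (Suc i)) \<le> w"
      unfolding w_def using D q_gt[of i] assms(4) by (intro iter_ln_weight_mono) auto
    have "prime_count_of S (q i) = Suc i"
      using card_le_enumerate[OF inf] by (simp add: prime_count_of_def P_def q_def)
    then have "real (Suc i) < real (q i) powr (1 / \<alpha>) / w"
      using N(2)[of "q i"] q_gt[of i] i by (simp add: w_def)
    then have "real (Suc i) * w \<le> real (q i) powr (1 / \<alpha>)"
      using v w by (simp add: field_simps)
    moreover have "real (Suc i) * iter_ln_weight k r (real (Suc i)) \<le> real (Suc i) * w"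
      using w by (intro mult_left_mono) auto
    ultimately have "real (Suc i) * iter_ln_weight k r (real (Suc i)) \<le> real (q i) powr (1 / \<alpha>)"
      by (rule order_trans[rotated])
    then have "1 / real (q i) powr (1 / \<alpha>) \<le> 1 / (real (Suc i) * iter_ln_weight k r (real (Suc i)))"
      using v by (intro divide_left_mono mult_pos_pos) (auto simp: prime prime_gt_0_nat)
    then show ?thesis by (simp add: powr_minus inverse_eq_divide)
  qed
  have "summable (\<lambda>i. 1 / (real (Suc i) * iter_ln_weight k r (real (Suc i))))"
    using summable_iter_ln_weight[OF assms(5,4)] by (rule summable_Suc_iff[THEN iffD2])
  then have sum: "summable (\<lambda>i. real (q i) powr - (1 / \<alpha>))"
    by (rule summable_comparison_test'[where N = N]) (use term_le in auto)
  \<comment> \<open>Take the value of the supposedly convergent series as the bound to be exceeded.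
    Pulled back along the bijection \<open>q\<close>, the sum over \<open>F\<close> is part of that
    series, a contradiction.\<close>
  obtain F where F: "finite F" "F \<subseteq> P"
    "(\<Sum>p\<in>F. real p powr - (1 / \<alpha>)) > (\<Sum>i. real (q i) powr - (1 / \<alpha>))"
    using sum_prime_divisors_unbounded[OF assms(1-3)] unfolding P_def by blast
  have bij: "bij_betw q UNIV P" unfolding q_def by (rule bij_enumerate[OF inf])
  then obtain I where I: "finite I" "F = q ` I"
    using finite_subset_image[OF F(1), of q UNIV] F(2) by (auto simp: bij_betw_def)
  have "(\<Sum>p\<in>F. real p powr - (1 / \<alpha>)) = (\<Sum>i\<in>I. real (q i) powr - (1 / \<alpha>))"
    unfolding I using bij by (subst sum.reindex) (auto simp: bij_betw_def inj_on_def)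
  also have "\<dots> \<le> (\<Sum>i. real (q i) powr - (1 / \<alpha>))"
    using sum I by (intro sum_le_suminf) auto
  finally show False using F by simp
qed

theorem corollary1:
  fixes \<alpha> :: real and S :: "nat set"
  assumes "\<alpha> \<ge> 1"
    and "infinite S"
    and "\<forall>s \<in> S. s > 0"
    and "poly_density \<alpha> S"
  shows "infinite (prime_divisors_of S) \<and>
    (\<forall>r :: real. r > 1 \<longrightarrow>
      (\<forall>k :: nat. k \<ge> 1 \<longrightarrow>
        infinite {n :: nat. n > 0 \<and> iter_ln_defined k (real n) \<and> iter_ln k (real n) > 0 \<and>
          real (prime_count_of S n) \<ge>
            real n powr (1 / \<alpha>) /
              ((\<Prod>j \<in> {1..k - 1}. iter_ln j (real n)) * iter_ln k (real n) powr r)}) \<and>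
      infinite {n :: nat. n > 0 \<and> ln (real n) > 0 \<and>
          real (prime_count_of S n) \<ge> real n powr (1 / \<alpha>) / ln (real n) powr r} \<and>
      infinite {n :: nat. n > 0 \<and> ln (real n) > 0 \<and> ln (ln (real n)) > 0 \<and>
          real (prime_count_of S n) \<ge>
            real n powr (1 / \<alpha>) / (ln (real n) * ln (ln (real n)) powr r)})"
proof (intro conjI allI impI)
  show "infinite (prime_divisors_of S)"
    using infinite_prime_divisors_of assms by blast
next
  fix r :: real assume "r > 1"
  note main = infinite_prime_count_ge[OF assms(1,3,4) \<open>r > 1\<close>, unfolded iter_ln_weight_def]
  show "infinite {n :: nat. n > 0 \<and> iter_ln_defined k (real n) \<and> iter_ln k (real n) > 0 \<and>
      real (prime_count_of S n) \<ge> real n powr (1 / \<alpha>) /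
        ((\<Prod>j \<in> {1..k - 1}. iter_ln j (real n)) * iter_ln k (real n) powr r)}"
    if "k \<ge> 1" for k
    using main[OF that] .
  show "infinite {n :: nat. n > 0 \<and> ln (real n) > 0 \<and>
      real (prime_count_of S n) \<ge> real n powr (1 / \<alpha>) / ln (real n) powr r}"
    \<comment> \<open>For \<open>k = 1\<close> the product is empty.\<close>
    by (rule infinite_super[OF _ main[of 1]]) auto
  show "infinite {n :: nat. n > 0 \<and> ln (real n) > 0 \<and> ln (ln (real n)) > 0 \<and>
      real (prime_count_of S n) \<ge>
        real n powr (1 / \<alpha>) / (ln (real n) * ln (ln (real n)) powr r)}"
    \<comment> \<open>For \<open>k = 2\<close> the product is the single factor \<open>ln n\<close>,
      whose positivity comes from \<open>iter_ln_defined 2\<close>.\<close>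
    by (rule infinite_super[OF _ main[of 2]])
      (auto simp: iter_ln_defined_def numeral_2_eq_2 less_Suc_eq)
qed

end
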